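(* Let $\Bbbk$ be a commutative ring and let $A$ be a (unital) Batalin-Vilkovisky algebra over $\Bbbk$ with operator $\Delta$ and bracket $\{-,-\}$. Equip the graded algebra $\mathrm{End}(A)$ of graded endomorphisms of $A$ (with composition) with the derived bracket $[f,g]_{-\Delta}:=[[f,-\Delta],g]$. Then the morphism of graded algebras induced by left multiplication $$\Psi:A\to\mathrm{End}(A),\quad a\mapsto l_a,\qquad l_a(b)=ab,$$ is an injective morphism of generalized Loday-Gerstenhaber algebras.
   Context: $[f,g]=f\circ g-(-1)^{|f||g|}g\circ f$ is the graded commutator in $\mathrm{End}(A)$. A Gerstenhaber algebra is a commutative graded algebra $A$ with $\{-,-\}:A_i\otimes A_j\to A_{i+j+1}$ such that $\{a,b\}=-(-1)^{(|a|+1)(|b|+1)}\{b,a\}$, $\{a,\{b,c\}\}=\{\{a,b\},c\}+(-1)^{(|a|+1)(|b|+1)}\{b,\{a,c\}\}$, $\{a,bc\}=\{a,b\}c+(-1)^{(|a|+1)|b|}b\{a,c\}$. A Batalin-Vilkovisky algebra is a Gerstenhaber algebra with a linear map $\Delta:A_i\to A_{i+1}$, $\Delta\circ\Delta=0$, such that $\{a,b\}=(-1)^{|a|}\left(\Delta(ab)-(\Delta a)b-(-1)^{|a|}a(\Delta b)\right)$. A generalized Loday-Gerstenhaber algebra is a (not necessarily commutative) graded algebra $E$ with a linear map $\{-,-\}:E_i\otimes E_j\to E_{i+j+1}$ satisfying $\{a,\{b,c\}\}=\{\{a,b\},c\}+(-1)^{(|a|+1)(|b|+1)}\{b,\{a,c\}\}$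 and $\{a,bc\}=\{a,b\}c+(-1)^{(|a|+1)|b|}b\{a,c\}$ (no antisymmetry required). Morphisms are morphisms of graded algebras preserving the brackets. *)

theory Defs
  imports "HOL-Algebra.Module" "HOL-Library.FuncSet"
begin

definition linear_maps ::
  "('k, 'r) ring_scheme \<Rightarrow> ('k, 'a, 'm) module_scheme \<Rightarrow> ('k, 'b, 'n) module_scheme \<Rightarrow> ('a \<Rightarrow> 'b) set"
where
  "linear_maps R M N = {f \<in> carrier M \<rightarrow> carrier N.
     (\<forall>x\<in>carrier M. \<forall>y\<in>carrier M. f (x \<oplus>\<^bsub>M\<^esub> y) = f x \<oplus>\<^bsub>N\<^esub> f y) \<and>
     (\<forall>r\<in>carrier R. \<forall>x\<in>carrier M. f (r \<odot>\<^bsub>M\<^esub> x) = r \<odot>\<^bsub>N\<^esub> f x)}"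

definition bilinear_maps ::
  "('k, 'r) ring_scheme \<Rightarrow> ('k, 'a, 'm) module_scheme \<Rightarrow> ('k, 'b, 'n) module_scheme \<Rightarrow>
   ('k, 'c, 'p) module_scheme \<Rightarrow> ('a \<Rightarrow> 'b \<Rightarrow> 'c) set"
where
  "bilinear_maps R M N P = {f.
     (\<forall>x\<in>carrier M. f x \<in> linear_maps R N P) \<and>
     (\<forall>y\<in>carrier N. (\<lambda>x. f x y) \<in> linear_maps R M P)}"

text \<open>The element $(-1)^n x$ of the module \<open>M\<close>.\<close>

definition signed :: "('a, 'm) ring_scheme \<Rightarrow> int \<Rightarrow> 'a \<Rightarrow> 'a" where
  "signed M n x = (if even n then x else \<ominus>\<^bsub>M\<^esub> x)"

text \<open>
  Graded modules are families of modules indexed by the integers, so that all elements are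
  homogeneous. As the components need not be disjoint, operations take the degrees of their
  arguments as explicit parameters: \<open>gmult A i j\<close> is the product $A_i \otimes A_j \to A_{i+j}$.
  The fields \<open>mult\<close> and \<open>one\<close> which the record type of modules inherits from rings are not used.
\<close>

record ('k, 'a) graded_algebra =
  gmod :: "int \<Rightarrow> ('k, 'a) module"
  gmult :: "int \<Rightarrow> int \<Rightarrow> 'a \<Rightarrow> 'a \<Rightarrow> 'a"
  gone :: "'a"

record ('k, 'a) bracket_algebra = "('k, 'a) graded_algebra" +
  gbracket :: "int \<Rightarrow> int \<Rightarrow> 'a \<Rightarrow> 'a \<Rightarrow> 'a"

locale graded_algebra =
  fixes R :: "('k, 'r) ring_scheme" and A :: "('k, 'a, 'm) graded_algebra_scheme"
  assumes module_gmod: "module R (gmod A i)"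
    and gmult_bilinear: "gmult A i j \<in> bilinear_maps R (gmod A i) (gmod A j) (gmod A (i + j))"
    and gone_closed: "gone A \<in> carrier (gmod A 0)"
    and gmult_assoc:
      "\<lbrakk>a \<in> carrier (gmod A i); b \<in> carrier (gmod A j); c \<in> carrier (gmod A k)\<rbrakk> \<Longrightarrow>
       gmult A (i + j) k (gmult A i j a b) c = gmult A i (j + k) a (gmult A j k b c)"
    and gone_left: "a \<in> carrier (gmod A i) \<Longrightarrow> gmult A 0 i (gone A) a = a"
    and gone_right: "a \<in> carrier (gmod A i) \<Longrightarrow> gmult A i 0 a (gone A) = a"

locale gen_loday_gerstenhaber_algebra = graded_algebra R A
  for R :: "('k, 'r) ring_scheme" and A :: "('k, 'a, 'm) bracket_algebra_scheme" +
  assumes gbracket_bilinear: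
      "gbracket A i j \<in> bilinear_maps R (gmod A i) (gmod A j) (gmod A (i + j + 1))"
    and gbracket_jacobi:
      "\<lbrakk>a \<in> carrier (gmod A i); b \<in> carrier (gmod A j); c \<in> carrier (gmod A k)\<rbrakk> \<Longrightarrow>
       gbracket A i (j + k + 1) a (gbracket A j k b c) =
       gbracket A (i + j + 1) k (gbracket A i j a b) c
         \<oplus>\<^bsub>gmod A (i + j + k + 2)\<^esub>
       signed (gmod A (i + j + k + 2)) ((i + 1) * (j + 1))
         (gbracket A j (i + k + 1) b (gbracket A i k a c))"
    and gbracket_gmult:
      "\<lbrakk>a \<in> carrier (gmod A i); b \<in> carrier (gmod A j); c \<in> carrier (gmod A k)\<rbrakk> \<Longrightarrow>
       gbracket A i (j + k) a (gmult A j k b c) =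
       gmult A (i + j + 1) k (gbracket A i j a b) c
         \<oplus>\<^bsub>gmod A (i + j + k + 1)\<^esub>
       signed (gmod A (i + j + k + 1)) ((i + 1) * j)
         (gmult A j (i + k + 1) b (gbracket A i k a c))"

locale gerstenhaber_algebra = gen_loday_gerstenhaber_algebra +
  assumes gmult_comm:
      "\<lbrakk>a \<in> carrier (gmod A i); b \<in> carrier (gmod A j)\<rbrakk> \<Longrightarrow>
       gmult A i j a b = signed (gmod A (i + j)) (i * j) (gmult A j i b a)"
    and gbracket_antisym:
      "\<lbrakk>a \<in> carrier (gmod A i); b \<in> carrier (gmod A j)\<rbrakk> \<Longrightarrow>
       gbracket A i j a b =
       \<ominus>\<^bsub>gmod A (i + j + 1)\<^esub> signed (gmod A (i + j + 1)) ((i + 1) * (j + 1)) (gbracket A j i b a)"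

locale batalin_vilkovisky_algebra = gerstenhaber_algebra R A
  for R :: "('k, 'r) ring_scheme" and A :: "('k, 'a, 'm) bracket_algebra_scheme" +
  fixes \<Delta> :: "int \<Rightarrow> 'a \<Rightarrow> 'a"
  assumes Delta_linear: "\<Delta> i \<in> linear_maps R (gmod A i) (gmod A (i + 1))"
    and Delta_Delta: "a \<in> carrier (gmod A i) \<Longrightarrow> \<Delta> (i + 1) (\<Delta> i a) = \<zero>\<^bsub>gmod A (i + 2)\<^esub>"
    and gbracket_Delta:
      "\<lbrakk>a \<in> carrier (gmod A i); b \<in> carrier (gmod A j)\<rbrakk> \<Longrightarrow>
       gbracket A i j a b =
       signed (gmod A (i + j + 1)) i
         (\<Delta> (i + j) (gmult A i j a b)
            \<ominus>\<^bsub>gmod A (i + j + 1)\<^esub> gmult A (i + 1) j (\<Delta> i a) b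
            \<ominus>\<^bsub>gmod A (i + j + 1)\<^esub> signed (gmod A (i + j + 1)) i (gmult A i (j + 1) a (\<Delta> j b)))"

locale gen_loday_gerstenhaber_hom =
  source: gen_loday_gerstenhaber_algebra R A + target: gen_loday_gerstenhaber_algebra R B
  for R :: "('k, 'r) ring_scheme"
    and A :: "('k, 'a, 'm) bracket_algebra_scheme" and B :: "('k, 'b, 'n) bracket_algebra_scheme" +
  fixes \<phi> :: "int \<Rightarrow> 'a \<Rightarrow> 'b"
  assumes hom_linear: "\<phi> i \<in> linear_maps R (gmod A i) (gmod B i)"
    and hom_gone: "\<phi> 0 (gone A) = gone B"
    and hom_gmult:
      "\<lbrakk>a \<in> carrier (gmod A i); b \<in> carrier (gmod A j)\<rbrakk> \<Longrightarrow>
       \<phi> (i + j) (gmult A i j a b) = gmult B i j (\<phi> i a) (\<phi> j b)"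
    and hom_gbracket:
      "\<lbrakk>a \<in> carrier (gmod A i); b \<in> carrier (gmod A j)\<rbrakk> \<Longrightarrow>
       \<phi> (i + j + 1) (gbracket A i j a b) = gbracket B i j (\<phi> i a) (\<phi> j b)"

text \<open>
  An endomorphism of degree \<open>i\<close> is a family of linear maps $A_k \to A_{i+k}$. To have one
  representative for each family, every component is \<open>undefined\<close> off the carrier of $A_k$.
\<close>

definition restrict_family ::
  "('k, 'a, 'm) graded_algebra_scheme \<Rightarrow> (int \<Rightarrow> 'a \<Rightarrow> 'a) \<Rightarrow> int \<Rightarrow> 'a \<Rightarrow> 'a"
where
  "restrict_family A f = (\<lambda>k. restrict (f k) (carrier (gmod A k)))"

definition graded_End_mod ::
  "('k, 'r) ring_scheme \<Rightarrow> ('k, 'a, 'm) graded_algebra_scheme \<Rightarrow> int \<Rightarrow> ('k, int \<Rightarrow> 'a \<Rightarrow> 'a) module"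
where
  "graded_End_mod R A i =
    \<lparr> carrier = {f. \<forall>k. f k \<in> linear_maps R (gmod A k) (gmod A (i + k)) \<inter>
                          extensional (carrier (gmod A k))},
      mult = undefined,
      one = undefined,
      zero = restrict_family A (\<lambda>k x. \<zero>\<^bsub>gmod A (i + k)\<^esub>),
      add = (\<lambda>f g. restrict_family A (\<lambda>k x. f k x \<oplus>\<^bsub>gmod A (i + k)\<^esub> g k x)),
      smult = (\<lambda>r f. restrict_family A (\<lambda>k x. r \<odot>\<^bsub>gmod A (i + k)\<^esub> f k x)) \<rparr>"

definition graded_End ::
  "('k, 'r) ring_scheme \<Rightarrow> ('k, 'a, 'm) graded_algebra_scheme \<Rightarrow> ('k, int \<Rightarrow> 'a \<Rightarrow> 'a) graded_algebra"
where
  "graded_End R A =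
    \<lparr> gmod = graded_End_mod R A,
      gmult = (\<lambda>i j f g. restrict_family A (\<lambda>k x. f (j + k) (g k x))),
      gone = restrict_family A (\<lambda>k x. x) \<rparr>"

definition graded_commutator ::
  "('k, 'e, 'm) graded_algebra_scheme \<Rightarrow> int \<Rightarrow> int \<Rightarrow> 'e \<Rightarrow> 'e \<Rightarrow> 'e"
where
  "graded_commutator E i j f g =
     gmult E i j f g \<ominus>\<^bsub>gmod E (i + j)\<^esub> signed (gmod E (i + j)) (i * j) (gmult E j i g f)"

text \<open>The derived bracket $[[f, d], g]$ of an element \<open>d\<close> of degree 1.\<close>

definition derived_bracket ::
  "('k, 'e, 'm) graded_algebra_scheme \<Rightarrow> 'e \<Rightarrow> int \<Rightarrow> int \<Rightarrow> 'e \<Rightarrow> 'e \<Rightarrow> 'e"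
where
  "derived_bracket E d i j f g =
     graded_commutator E (i + 1) j (graded_commutator E i 1 f d) g"

definition derived_algebra ::
  "('k, 'e) graded_algebra \<Rightarrow> 'e \<Rightarrow> ('k, 'e) bracket_algebra"
where
  "derived_algebra E d =
     graded_algebra.extend E \<lparr> gbracket = derived_bracket E d \<rparr>"

definition left_mult ::
  "('k, 'a, 'm) graded_algebra_scheme \<Rightarrow> int \<Rightarrow> 'a \<Rightarrow> int \<Rightarrow> 'a \<Rightarrow> 'a"
where
  "left_mult A i a = restrict_family A (\<lambda>k b. gmult A i k a b)"

end

(* Square-zero elements d of degree 1 of any graded algebra yield generalized Loday-Gerstenhaber
   structures: [x, -] is a derivation of the product, hence of the commutator, and [[f, d], d] = 0
   turns [[f, d], [g, d]] into [[[f, d], g], d], so the Jacobi identity for commutators becomes the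
   one for [[f, d], g].  For l_a the defining identity of the BV bracket reads
   [l_a, -Delta] = {a, -} + (-1)^|a| l_(Delta a).  The second summand commutes with l_b, and the
   Leibniz rule gives [{a, -}, l_b] = l_{a,b}.  Evaluation at the unit shows injectivity. *)

theory Submission
  imports Defs
begin

section \<open>Signs and linear maps\<close>

context abelian_group
begin

lemma signed_closed [simp]: "x \<in> carrier G \<Longrightarrow> signed G n x \<in> carrier G"
  by (simp add: signed_def)

lemma signed_add:
  "\<lbrakk>x \<in> carrier G; y \<in> carrier G\<rbrakk> \<Longrightarrow> signed G n (x \<oplus> y) = signed G n x \<oplus> signed G n y"
  by (simp add: signed_def minus_add)

lemma signed_a_inv: "signed G n (\<ominus> x) = \<ominus> signed G n x"
  by (simp add: signed_def)

lemma signed_minus: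
  "\<lbrakk>x \<in> carrier G; y \<in> carrier G\<rbrakk> \<Longrightarrow> signed G n (x \<ominus> y) = signed G n x \<ominus> signed G n y"
  by (simp add: a_minus_def signed_add signed_a_inv)

lemma signed_signed: "x \<in> carrier G \<Longrightarrow> signed G m (signed G n x) = signed G (m + n) x"
  by (auto simp: signed_def)

lemma signed_zero [simp]: "signed G n \<zero> = \<zero>"
  by (simp add: signed_def)

text \<open>Sorting a sum with \<open>a_ac\<close> can leave a summand standing between
  \<open>x\<close> and its inverse, where the usual cancellation rules miss the pair; as a rewrite
  rule this closes the gap.\<close>

lemma a_inv_lcancel:
  "\<lbrakk>x \<in> carrier G; y \<in> carrier G; z \<in> carrier G\<rbrakk> \<Longrightarrow> x \<oplus> (y \<oplus> (\<ominus> x \<oplus> z)) = y \<oplus> z"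
  by (simp add: a_lcomm[of x y] r_neg2)

text \<open>The telescoping that removes the mixed products in
  \<open>commutator_gmult\<close>.\<close>

lemma minus_add_minus:
  "\<lbrakk>x \<in> carrier G; y \<in> carrier G; z \<in> carrier G\<rbrakk> \<Longrightarrow> (x \<ominus> y) \<oplus> (y \<ominus> z) = x \<ominus> z"
  by (simp add: a_minus_def a_assoc r_neg1)

lemma add_minus_add:
  "\<lbrakk>x \<in> carrier G; y \<in> carrier G; x' \<in> carrier G; y' \<in> carrier G\<rbrakk> \<Longrightarrow>
   (x \<oplus> y) \<ominus> (x' \<oplus> y') = (x \<ominus> x') \<oplus> (y \<ominus> y')"
  by (simp add: a_minus_def minus_add a_ac)

end

lemma (in module) smult_signed:
  "\<lbrakk>r \<in> carrier R; x \<in> carrier M\<rbrakk> \<Longrightarrow> r \<odot>\<^bsub>M\<^esub> signed M n x = signed M n (r \<odot>\<^bsub>M\<^esub> x)"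
  by (simp add: signed_def smult_r_minus)

lemma (in module) smult_minus:
  "\<lbrakk>r \<in> carrier R; x \<in> carrier M; y \<in> carrier M\<rbrakk> \<Longrightarrow>
   r \<odot>\<^bsub>M\<^esub> (x \<ominus>\<^bsub>M\<^esub> y) = r \<odot>\<^bsub>M\<^esub> x \<ominus>\<^bsub>M\<^esub> r \<odot>\<^bsub>M\<^esub> y"
  by (simp add: a_minus_def smult_r_minus smult_r_distr)

section \<open>Linear and bilinear maps between modules\<close>

lemma linear_mapsI:
  assumes "\<And>x. x \<in> carrier M \<Longrightarrow> f x \<in> carrier N"
    and "\<And>x y. \<lbrakk>x \<in> carrier M; y \<in> carrier M\<rbrakk> \<Longrightarrow> f (x \<oplus>\<^bsub>M\<^esub> y) = f x \<oplus>\<^bsub>N\<^esub> f y"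
    and "\<And>r x. \<lbrakk>r \<in> carrier R; x \<in> carrier M\<rbrakk> \<Longrightarrow> f (r \<odot>\<^bsub>M\<^esub> x) = r \<odot>\<^bsub>N\<^esub> f x"
  shows "f \<in> linear_maps R M N"
  using assms by (auto simp: linear_maps_def)

lemma bilinear_mapsI:
  assumes "\<And>x y. \<lbrakk>x \<in> carrier M; y \<in> carrier N\<rbrakk> \<Longrightarrow> f x y \<in> carrier P"
    and "\<And>x x' y. \<lbrakk>x \<in> carrier M; x' \<in> carrier M; y \<in> carrier N\<rbrakk> \<Longrightarrow>
           f (x \<oplus>\<^bsub>M\<^esub> x') y = f x y \<oplus>\<^bsub>P\<^esub> f x' y"
    and "\<And>r x y. \<lbrakk>r \<in> carrier R; x \<in> carrier M; y \<in> carrier N\<rbrakk> \<Longrightarrow>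
           f (r \<odot>\<^bsub>M\<^esub> x) y = r \<odot>\<^bsub>P\<^esub> f x y"
    and "\<And>x y y'. \<lbrakk>x \<in> carrier M; y \<in> carrier N; y' \<in> carrier N\<rbrakk> \<Longrightarrow>
           f x (y \<oplus>\<^bsub>N\<^esub> y') = f x y \<oplus>\<^bsub>P\<^esub> f x y'"
    and "\<And>r x y. \<lbrakk>r \<in> carrier R; x \<in> carrier M; y \<in> carrier N\<rbrakk> \<Longrightarrow>
           f x (r \<odot>\<^bsub>N\<^esub> y) = r \<odot>\<^bsub>P\<^esub> f x y"
  shows "f \<in> bilinear_maps R M N P"
  using assms by (auto simp: bilinear_maps_def linear_maps_def)

text \<open>Linearity only tests values on the carrier, which is closed under addition and scalars,
  so the normalisation built into \<open>restrict_family\<close> never affects it.\<close>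

lemma linear_maps_restrict:
  assumes "module R M"
  shows "restrict f (carrier M) \<in> linear_maps R M N \<longleftrightarrow> f \<in> linear_maps R M N"
proof -
  interpret module R M by fact
  show ?thesis by (auto simp: linear_maps_def Pi_iff)
qed

text \<open>One common home for products with a fixed factor, commutators with a fixed entry,
  components of endomorphisms and the operator: each obtains the rules for zero, negatives,
  differences and signs by a single instantiation.\<close>

locale linear_map = M: module R M + N: module R N
  for R :: "('k, 'r) ring_scheme"
    and M :: "('k, 'a, 'm) module_scheme" and N :: "('k, 'b, 'n) module_scheme" +
  fixes f
  assumes linear: "f \<in> linear_maps R M N"
begin

lemma closed [simp]: "x \<in> carrier M \<Longrightarrow> f x \<in> carrier N"
  using linear by (auto simp: linear_maps_def)

lemma map_add:
  "\<lbrakk>x \<in> carrier M; y \<in> carrier M\<rbrakk> \<Longrightarrow> f (x \<oplus>\<^bsub>M\<^esub> y) = f x \<oplus>\<^bsub>N\<^esub> f y"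
  using linear by (auto simp: linear_maps_def)

lemma map_smult:
  "\<lbrakk>r \<in> carrier R; x \<in> carrier M\<rbrakk> \<Longrightarrow> f (r \<odot>\<^bsub>M\<^esub> x) = r \<odot>\<^bsub>N\<^esub> f x"
  using linear by (auto simp: linear_maps_def)

lemma map_zero: "f \<zero>\<^bsub>M\<^esub> = \<zero>\<^bsub>N\<^esub>"
  using map_add[of "\<zero>\<^bsub>M\<^esub>" "\<zero>\<^bsub>M\<^esub>"] by simp

lemma map_a_inv: "x \<in> carrier M \<Longrightarrow> f (\<ominus>\<^bsub>M\<^esub> x) = \<ominus>\<^bsub>N\<^esub> f x"
  using map_add[of "\<ominus>\<^bsub>M\<^esub> x" x]
  by (simp add: M.M.l_neg map_zero N.M.minus_equality)

lemma map_minus: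
  "\<lbrakk>x \<in> carrier M; y \<in> carrier M\<rbrakk> \<Longrightarrow> f (x \<ominus>\<^bsub>M\<^esub> y) = f x \<ominus>\<^bsub>N\<^esub> f y"
  by (simp add: a_minus_def map_add map_a_inv)

lemma map_signed: "x \<in> carrier M \<Longrightarrow> f (signed M n x) = signed N n (f x)"
  by (simp add: signed_def map_a_inv)

end

section \<open>The graded commutator\<close>

context graded_algebra
begin

sublocale gmod: module R "gmod A i" for i
  by (rule module_gmod)

lemma linear_map_gmult_right:
  "\<lbrakk>a \<in> carrier (gmod A i); k = i + j\<rbrakk> \<Longrightarrow> linear_map R (gmod A j) (gmod A k) (gmult A i j a)"
  using gmult_bilinear[of i j]
  by (auto intro!: linear_map.intro linear_map_axioms.intro module_gmod simp: bilinear_maps_def)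

lemma linear_map_gmult_left:
  "\<lbrakk>b \<in> carrier (gmod A j); k = i + j\<rbrakk> \<Longrightarrow>
   linear_map R (gmod A i) (gmod A k) (\<lambda>a. gmult A i j a b)"
  using gmult_bilinear[of i j]
  by (auto intro!: linear_map.intro linear_map_axioms.intro module_gmod simp: bilinear_maps_def)

text \<open>Degrees of results are variables constrained by equations, since sums of degrees rarely
  arise in the syntactic form in which they are needed.\<close>

lemma gmult_closed:
  "\<lbrakk>a \<in> carrier (gmod A i); b \<in> carrier (gmod A j); k = i + j\<rbrakk> \<Longrightarrow>
   gmult A i j a b \<in> carrier (gmod A k)"
  using linear_map.closed[OF linear_map_gmult_right] by blast

lemma gmult_assoc':
  "\<lbrakk>a \<in> carrier (gmod A i); b \<in> carrier (gmod A j); c \<in> carrier (gmod A k);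
    m = i + j; n = j + k\<rbrakk> \<Longrightarrow>
   gmult A m k (gmult A i j a b) c = gmult A i n a (gmult A j k b c)"
  using gmult_assoc by blast

lemmas gmult_right_simps =
  linear_map.map_add[OF linear_map_gmult_right] linear_map.map_minus[OF linear_map_gmult_right]
  linear_map.map_a_inv[OF linear_map_gmult_right] linear_map.map_signed[OF linear_map_gmult_right]
  linear_map.map_smult[OF linear_map_gmult_right] linear_map.map_zero[OF linear_map_gmult_right]

lemmas gmult_left_simps =
  linear_map.map_add[OF linear_map_gmult_left] linear_map.map_minus[OF linear_map_gmult_left]
  linear_map.map_a_inv[OF linear_map_gmult_left] linear_map.map_signed[OF linear_map_gmult_left]
  linear_map.map_smult[OF linear_map_gmult_left] linear_map.map_zero[OF linear_map_gmult_left]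

lemma graded_commutator_bilinear:
  "graded_commutator A i j \<in> bilinear_maps R (gmod A i) (gmod A j) (gmod A (i + j))"
proof (rule bilinear_mapsI)
  \<comment> \<open>The reversed product lies in degree \<open>j + i\<close>;
    \<open>add.commute\<close> identifies this with \<open>i + j\<close>.\<close>
  note [simp] = graded_commutator_def gmult_closed add.commute
    gmod.smult_minus gmod.smult_signed gmod.M.signed_add gmod.M.add_minus_add
    gmult_left_simps[where k = "i + j"] gmult_right_simps[where k = "i + j"]
  fix x x' y y' r
  assume [simp]: "x \<in> carrier (gmod A i)" "y \<in> carrier (gmod A j)"
  show "graded_commutator A i j x y \<in> carrier (gmod A (i + j))"
    by simp
  show "graded_commutator A i j (x \<oplus>\<^bsub>gmod A i\<^esub> x') y =
      graded_commutator A i j x y \<oplus>\<^bsub>gmod A (i + j)\<^esub> graded_commutator A i j x' y"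
    if "x' \<in> carrier (gmod A i)"
    using that by simp
  show "graded_commutator A i j x (y \<oplus>\<^bsub>gmod A j\<^esub> y') =
      graded_commutator A i j x y \<oplus>\<^bsub>gmod A (i + j)\<^esub> graded_commutator A i j x y'"
    if "y' \<in> carrier (gmod A j)"
    using that by simp
  assume [simp]: "r \<in> carrier R"
  show "graded_commutator A i j (r \<odot>\<^bsub>gmod A i\<^esub> x) y =
      r \<odot>\<^bsub>gmod A (i + j)\<^esub> graded_commutator A i j x y"
    by simp
  show "graded_commutator A i j x (r \<odot>\<^bsub>gmod A j\<^esub> y) =
      r \<odot>\<^bsub>gmod A (i + j)\<^esub> graded_commutator A i j x y"
    by simp
qed

lemma linear_map_commutator_right:
  "\<lbrakk>a \<in> carrier (gmod A i); k = i + j\<rbrakk> \<Longrightarrow>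
   linear_map R (gmod A j) (gmod A k) (graded_commutator A i j a)"
  using graded_commutator_bilinear[of i j]
  by (auto intro!: linear_map.intro linear_map_axioms.intro module_gmod simp: bilinear_maps_def)

lemma linear_map_commutator_left:
  "\<lbrakk>b \<in> carrier (gmod A j); k = i + j\<rbrakk> \<Longrightarrow>
   linear_map R (gmod A i) (gmod A k) (\<lambda>a. graded_commutator A i j a b)"
  using graded_commutator_bilinear[of i j]
  by (auto intro!: linear_map.intro linear_map_axioms.intro module_gmod simp: bilinear_maps_def)

lemma commutator_closed:
  "\<lbrakk>a \<in> carrier (gmod A i); b \<in> carrier (gmod A j); k = i + j\<rbrakk> \<Longrightarrow>
   graded_commutator A i j a b \<in> carrier (gmod A k)"
  using linear_map.closed[OF linear_map_commutator_right] by blast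

text \<open>\<open>[x, -]\<close> is a graded derivation. With P = xgh, Q = gxh and S = ghx, the two
  summands on the right contain Q with opposite signs, and the sign left on S is that of i(j +
  k).\<close>

lemma commutator_gmult:
  assumes [simp]: "x \<in> carrier (gmod A i)" "g \<in> carrier (gmod A j)" "h \<in> carrier (gmod A k)"
    and deg: "n = i + j + k" "jk = j + k" "ij = i + j" "ik = i + k"
  shows "graded_commutator A i jk x (gmult A j k g h) =
    gmult A ij k (graded_commutator A i j x g) h \<oplus>\<^bsub>gmod A n\<^esub>
    signed (gmod A n) (i * j) (gmult A j ik g (graded_commutator A i k x h))"
proof -
  define P where "P = gmult A i jk x (gmult A j k g h)"
  define Q where "Q = gmult A j ik g (gmult A i k x h)"
  define S where "S = gmult A j ik g (gmult A k i h x)"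
  have [simp]: "P \<in> carrier (gmod A n)" "Q \<in> carrier (gmod A n)" "S \<in> carrier (gmod A n)"
    unfolding P_def Q_def S_def by (auto intro!: gmult_closed simp: deg)
  have c: "gmult A i j x g \<in> carrier (gmod A ij)" "gmult A j i g x \<in> carrier (gmod A ij)"
    "gmult A i k x h \<in> carrier (gmod A ik)" "gmult A k i h x \<in> carrier (gmod A ik)"
    by (auto intro!: gmult_closed simp: deg)
  have 1: "gmult A ij k (graded_commutator A i j x g) h = P \<ominus>\<^bsub>gmod A n\<^esub> signed (gmod A n) (i * j) Q"
    using c unfolding graded_commutator_def P_def Q_def deg(3)[symmetric]
    by (simp add: gmult_left_simps[where k = n] gmult_assoc'[where n = jk]
        gmult_assoc'[where n = ik] deg)
  have 2: "gmult A j ik g (graded_commutator A i k x h) = Q \<ominus>\<^bsub>gmod A n\<^esub> signed (gmod A n) (i * k) S"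
    using c unfolding graded_commutator_def Q_def S_def deg(4)[symmetric]
    by (simp add: gmult_right_simps[where k = n] deg)
  have 3: "graded_commutator A i jk x (gmult A j k g h) =
      P \<ominus>\<^bsub>gmod A n\<^esub> signed (gmod A n) (i * jk) S"
    unfolding graded_commutator_def P_def S_def
    by (simp add: gmult_assoc'[where n = ik] deg add.assoc)
  show ?thesis
    unfolding 1 2 3
    by (simp add: gmod.M.signed_minus gmod.M.signed_signed gmod.M.minus_add_minus deg(2)
        distrib_left)
qed

text \<open>A derivation of the product is one of the commutator: apply
  \<open>commutator_gmult\<close> to gh and to hg and regroup the four resulting products X =
  [x,g]h, Y = g[x,h], Z = [x,h]g and W = h[x,g].\<close>

lemma commutator_jacobi:
  assumes [simp]: "x \<in> carrier (gmod A i)" "g \<in> carrier (gmod A j)" "h \<in> carrier (gmod A k)"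
    and deg: "n = i + j + k" "jk = j + k" "ij = i + j" "ik = i + k"
  shows "graded_commutator A i jk x (graded_commutator A j k g h) =
    graded_commutator A ij k (graded_commutator A i j x g) h \<oplus>\<^bsub>gmod A n\<^esub>
    signed (gmod A n) (i * j) (graded_commutator A j ik g (graded_commutator A i k x h))"
proof -
  define X where "X = gmult A ij k (graded_commutator A i j x g) h"
  define Y where "Y = gmult A j ik g (graded_commutator A i k x h)"
  define Z where "Z = gmult A ik j (graded_commutator A i k x h) g"
  define W where "W = gmult A k ij h (graded_commutator A i j x g)"
  have [simp]: "X \<in> carrier (gmod A n)" "Y \<in> carrier (gmod A n)" "Z \<in> carrier (gmod A n)"
    "W \<in> carrier (gmod A n)"
    unfolding X_def Y_def Z_def W_def by (auto intro!: gmult_closed commutator_closed simp: deg)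
  have n: "i + jk = n" "ij + k = n" "j + ik = n" "j + k = jk"
    by (simp_all add: deg)
  have c: "gmult A j k g h \<in> carrier (gmod A jk)" "gmult A k j h g \<in> carrier (gmod A jk)"
    by (auto intro!: gmult_closed simp: deg)
  interpret D: linear_map R "gmod A jk" "gmod A n" "graded_commutator A i jk x"
    by (rule linear_map_commutator_right) (simp_all add: n)
  \<comment> \<open>Only the inner commutator is expanded; the outer one stays folded as the linear
    map to which the derivation rule applies.\<close>
  have "graded_commutator A i jk x (graded_commutator A j k g h) =
      graded_commutator A i jk x (gmult A j k g h) \<ominus>\<^bsub>gmod A n\<^esub>
      signed (gmod A n) (j * k) (graded_commutator A i jk x (gmult A k j h g))"
    using c by (simp add: graded_commutator_def[of A j k] n D.map_minus D.map_signed)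
  also have "graded_commutator A i jk x (gmult A j k g h) =
      X \<oplus>\<^bsub>gmod A n\<^esub> signed (gmod A n) (i * j) Y"
    unfolding X_def Y_def by (rule commutator_gmult) (simp_all add: deg)
  also have "graded_commutator A i jk x (gmult A k j h g) =
      Z \<oplus>\<^bsub>gmod A n\<^esub> signed (gmod A n) (i * k) W"
    unfolding Z_def W_def by (rule commutator_gmult) (simp_all add: deg)
  finally have 1: "graded_commutator A i jk x (graded_commutator A j k g h) =
      X \<oplus>\<^bsub>gmod A n\<^esub> signed (gmod A n) (i * j) Y \<ominus>\<^bsub>gmod A n\<^esub>
      signed (gmod A n) (j * k) (Z \<oplus>\<^bsub>gmod A n\<^esub> signed (gmod A n) (i * k) W)" .
  have 2: "graded_commutator A ij k (graded_commutator A i j x g) h =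
      X \<ominus>\<^bsub>gmod A n\<^esub> signed (gmod A n) (ij * k) W"
    by (simp add: graded_commutator_def[of A ij k] n X_def W_def)
  have 3: "graded_commutator A j ik g (graded_commutator A i k x h) =
      Y \<ominus>\<^bsub>gmod A n\<^esub> signed (gmod A n) (j * ik) Z"
    by (simp add: graded_commutator_def[of A j ik] n Y_def Z_def)
  show ?thesis
    unfolding 1 2 3
    \<comment> \<open>Both sides are now signed sums of X, Y, Z and W, and the signs depend only on
      the parities of the three degrees.\<close>
    by (cases "even i"; cases "even j"; cases "even k")
      (simp_all add: signed_def deg(2-4) a_minus_def gmod.M.minus_add gmod.M.a_ac)
qed

end

section \<open>Derived brackets\<close>

text \<open>The condition is dd = 0 rather than [d, d] = 0: in degree 1 the commutator [d, d] equals
  2dd, and 2 need not be invertible in the ground ring.\<close>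

locale square_zero = graded_algebra R E
  for R :: "('k, 'r) ring_scheme" and E :: "('k, 'e) graded_algebra" +
  fixes d
  assumes d_closed [simp]: "d \<in> carrier (gmod E 1)"
    and d_square: "gmult E 1 1 d d = \<zero>\<^bsub>gmod E 2\<^esub>"
begin

text \<open>Of the four products in the expansion, fdd and ddf contain dd and vanish. The product
  dfd occurs twice, once with the sign of i and once with that of i + 1, after the minus of the
  commutators is taken into account, and cancels.\<close>

lemma commutator_d_d:
  assumes [simp]: "f \<in> carrier (gmod E i)" and deg: "i' = i + 1"
  shows "graded_commutator E i' 1 (graded_commutator E i 1 f d) d = \<zero>\<^bsub>gmod E (i + 2)\<^esub>"
proof -
  define P where "P = gmult E 1 i' d (gmult E i 1 f d)"
  have P [simp]: "P \<in> carrier (gmod E (i + 2))"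
    unfolding P_def by (auto intro!: gmult_closed simp: deg)
  have c: "gmult E i 1 f d \<in> carrier (gmod E i')" "gmult E 1 i d f \<in> carrier (gmod E i')"
    by (auto intro!: gmult_closed simp: deg)
  have fdd: "gmult E i' 1 (gmult E i 1 f d) d = \<zero>\<^bsub>gmod E (i + 2)\<^esub>"
    by (simp add: gmult_assoc'[where n = 2] deg d_square gmult_right_simps)
  have ddf: "gmult E 1 i' d (gmult E 1 i d f) = \<zero>\<^bsub>gmod E (i + 2)\<^esub>"
    \<comment> \<open>Associativity is read from right to left here, to expose the factor
      dd.\<close>
    using gmult_assoc'[of d 1 d 1 f i 2 i']
    by (simp add: deg d_square gmult_left_simps[where k = "i + 2"])
  have dfd: "gmult E i' 1 (gmult E 1 i d f) d = P"
    by (simp add: P_def gmult_assoc'[where n = i'] deg)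
  have deg': "i + 2 = i' + 1" "i + 2 = 1 + i'"
    by (simp_all add: deg)
  have comm: "graded_commutator E i 1 f d =
      gmult E i 1 f d \<ominus>\<^bsub>gmod E i'\<^esub> signed (gmod E i') i (gmult E 1 i d f)"
    by (simp add: graded_commutator_def deg add.commute)
  have "gmult E i' 1 (graded_commutator E i 1 f d) d =
      \<zero>\<^bsub>gmod E (i + 2)\<^esub> \<ominus>\<^bsub>gmod E (i + 2)\<^esub> signed (gmod E (i + 2)) i P"
    using c by (simp add: comm fdd dfd gmult_left_simps(2,4)[OF d_closed deg'(1)])
  moreover have "gmult E 1 i' d (graded_commutator E i 1 f d) = P"
    using c by (simp add: a_minus_def comm ddf P_def[symmetric] gmult_right_simps(1,3,4)[OF d_closed deg'(2)])
  moreover have "graded_commutator E i' 1 (graded_commutator E i 1 f d) d =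
      gmult E i' 1 (graded_commutator E i 1 f d) d \<ominus>\<^bsub>gmod E (i + 2)\<^esub>
      signed (gmod E (i + 2)) (i + 1) (gmult E 1 i' d (graded_commutator E i 1 f d))"
    by (simp add: graded_commutator_def[of E i' 1] deg'(1) flip: deg)
  ultimately show ?thesis
    by (simp add: signed_def a_minus_def gmod.M.l_neg gmod.M.r_neg)
qed

lemma derived_bracket_closed:
  "\<lbrakk>f \<in> carrier (gmod E i); g \<in> carrier (gmod E j); k = i + j + 1\<rbrakk> \<Longrightarrow>
   derived_bracket E d i j f g \<in> carrier (gmod E k)"
  unfolding derived_bracket_def by (auto intro!: commutator_closed)

lemma derived_bracket_bilinear:
  "derived_bracket E d i j \<in> bilinear_maps R (gmod E i) (gmod E j) (gmod E (i + j + 1))"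
proof -
  interpret L: linear_map R "gmod E i" "gmod E (i + 1)" "\<lambda>f. graded_commutator E i 1 f d"
    by (rule linear_map_commutator_left) simp_all
  have right: "linear_map R (gmod E j) (gmod E (i + j + 1)) (derived_bracket E d i j f)"
    if "f \<in> carrier (gmod E i)" for f
    unfolding derived_bracket_def using that by (auto intro!: linear_map_commutator_right)
  have left: "linear_map R (gmod E (i + 1)) (gmod E (i + j + 1))
      (\<lambda>f. graded_commutator E (i + 1) j f g)"
    if "g \<in> carrier (gmod E j)" for g
    using that by (auto intro!: linear_map_commutator_left)
  show ?thesis
    \<comment> \<open>Linearity in the second argument is settled with the bracket folded. The first
      argument passes through two linear maps, first \<open>[-, d]\<close> and then the commutator
      with the second argument, so there the bracket is unfolded.\<close>
    by (rule bilinear_mapsI)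
      (simp_all add: derived_bracket_closed linear_map.map_add[OF right]
        linear_map.map_smult[OF right],
       simp_all add: derived_bracket_def L.map_add L.map_smult linear_map.map_add[OF left]
        linear_map.map_smult[OF left])
qed

lemma derived_bracket_jacobi:
  assumes [simp]: "f \<in> carrier (gmod E i)" "g \<in> carrier (gmod E j)" "h \<in> carrier (gmod E k)"
  shows "derived_bracket E d i (j + k + 1) f (derived_bracket E d j k g h) =
    derived_bracket E d (i + j + 1) k (derived_bracket E d i j f g) h
      \<oplus>\<^bsub>gmod E (i + j + k + 2)\<^esub>
    signed (gmod E (i + j + k + 2)) ((i + 1) * (j + 1))
      (derived_bracket E d j (i + k + 1) g (derived_bracket E d i k f h))"
proof -
  define x where "x = graded_commutator E i 1 f d"
  define y where "y = graded_commutator E j 1 g d"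
  have [simp]: "x \<in> carrier (gmod E (i + 1))" "y \<in> carrier (gmod E (j + 1))"
    by (auto simp: x_def y_def intro!: commutator_closed)
  have c: "graded_commutator E (i + 1) j x g \<in> carrier (gmod E (i + j + 1))"
    by (auto intro!: commutator_closed)
  have cd: "graded_commutator E (i + j + 1) 1 (graded_commutator E (i + 1) j x g) d
      \<in> carrier (gmod E (i + j + 2))"
    using c by (auto intro!: commutator_closed)
  \<comment> \<open>Jacobi for x, g and d. Its last term contains [x, d] = [[f, d], d] = 0, so
    [x, y] = [[x, g], d]: taking the commutator with d turns the derived bracket of f and g into
    [x, y].\<close>
  have "graded_commutator E (i + 1) (j + 1) x y =
      graded_commutator E (i + j + 1) 1 (graded_commutator E (i + 1) j x g) d
        \<oplus>\<^bsub>gmod E (i + j + 2)\<^esub> signed (gmod E (i + j + 2)) ((i + 1) * j)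
          (graded_commutator E j (i + 2) g (graded_commutator E (i + 1) 1 x d))"
    unfolding y_def by (rule commutator_jacobi) simp_all
  also have "graded_commutator E j (i + 2) g (graded_commutator E (i + 1) 1 x d) =
      \<zero>\<^bsub>gmod E (i + j + 2)\<^esub>"
    unfolding x_def
    by (simp add: commutator_d_d
        linear_map.map_zero[OF linear_map_commutator_right[where k = "i + j + 2"]])
  finally have xy: "graded_commutator E (i + 1) (j + 1) x y =
      graded_commutator E (i + j + 1) 1 (graded_commutator E (i + 1) j x g) d"
    using cd by simp
  \<comment> \<open>A second use of Jacobi, now for x, y and h. The degrees i + 1 and j + 1 of x and
    y give exactly the shifted sign of the derived bracket.\<close>
  have "graded_commutator E (i + 1) (j + k + 1) x (graded_commutator E (j + 1) k y h) =
      graded_commutator E (i + j + 1 + 1) k (graded_commutator E (i + 1) (j + 1) x y) h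
        \<oplus>\<^bsub>gmod E (i + j + k + 2)\<^esub> signed (gmod E (i + j + k + 2)) ((i + 1) * (j + 1))
          (graded_commutator E (j + 1) (i + k + 1) y (graded_commutator E (i + 1) k x h))"
    by (rule commutator_jacobi) simp_all
  then show ?thesis
    unfolding derived_bracket_def xy by (simp only: x_def y_def)
qed

text \<open>This is the derivation rule for the commutator with [f, d]; its degree i + 1 accounts
  for the sign.\<close>

lemma derived_bracket_gmult:
  assumes [simp]: "f \<in> carrier (gmod E i)" "g \<in> carrier (gmod E j)" "h \<in> carrier (gmod E k)"
  shows "derived_bracket E d i (j + k) f (gmult E j k g h) =
    gmult E (i + j + 1) k (derived_bracket E d i j f g) h
      \<oplus>\<^bsub>gmod E (i + j + k + 1)\<^esub>
    signed (gmod E (i + j + k + 1)) ((i + 1) * j)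
      (gmult E j (i + k + 1) g (derived_bracket E d i k f h))"
  unfolding derived_bracket_def
  by (rule commutator_gmult) (auto intro!: commutator_closed)

lemma derived_algebra_simps:
  "gmod (derived_algebra E d) = gmod E" "gmult (derived_algebra E d) = gmult E"
  "gone (derived_algebra E d) = gone E" "gbracket (derived_algebra E d) = derived_bracket E d"
  by (simp_all add: derived_algebra_def graded_algebra.extend_def)

lemma gen_loday_gerstenhaber_derived_algebra:
  "gen_loday_gerstenhaber_algebra R (derived_algebra E d)"
proof (intro gen_loday_gerstenhaber_algebra.intro gen_loday_gerstenhaber_algebra_axioms.intro)
  show "graded_algebra R (derived_algebra E d)"
    \<comment> \<open>The axioms mention the record only through its selectors, and extending it by
      a bracket leaves the old ones unchanged.\<close>
    using graded_algebra_axioms unfolding graded_algebra_def derived_algebra_simps .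
qed (unfold derived_algebra_simps,
    (fact derived_bracket_bilinear derived_bracket_jacobi derived_bracket_gmult)+)

end

section \<open>Graded endomorphisms\<close>

context graded_algebra
begin

lemma restrict_family_apply [simp]:
  "x \<in> carrier (gmod A k) \<Longrightarrow> restrict_family A f k x = f k x"
  by (simp add: restrict_family_def)

lemma restrict_family_closed [simp]:
  "restrict_family A f \<in> carrier (graded_End_mod R A i) \<longleftrightarrow>
   (\<forall>k. f k \<in> linear_maps R (gmod A k) (gmod A (i + k)))"
  by (simp add: graded_End_mod_def restrict_family_def linear_maps_restrict[OF module_gmod])

lemma graded_End_linear_map:
  "\<lbrakk>f \<in> carrier (graded_End_mod R A i); n = i + k\<rbrakk> \<Longrightarrow> linear_map R (gmod A k) (gmod A n) (f k)"
  by (auto intro!: linear_map.intro linear_map_axioms.intro module_gmod simp: graded_End_mod_def)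

lemma graded_End_closed:
  "\<lbrakk>f \<in> carrier (graded_End_mod R A i); x \<in> carrier (gmod A k); n = i + k\<rbrakk> \<Longrightarrow>
   f k x \<in> carrier (gmod A n)"
  using linear_map.closed[OF graded_End_linear_map] by blast

lemmas graded_End_map_simps =
  linear_map.map_add[OF graded_End_linear_map] linear_map.map_smult[OF graded_End_linear_map]

text \<open>Components are \<open>undefined\<close> off the carriers, so agreement on the carriers
  is enough. Identities between endomorphisms are reduced to elements of \<open>A\<close> through
  this rule.\<close>

lemma graded_End_eqI:
  assumes "f \<in> carrier (graded_End_mod R A i)" "g \<in> carrier (graded_End_mod R A i)"
    and "\<And>k x. x \<in> carrier (gmod A k) \<Longrightarrow> f k x = g k x"
  shows "f = g"
proof
  show "f k = g k" for k
    using assms by (intro extensionalityI[of _ "carrier (gmod A k)"]) (auto simp: graded_End_mod_def)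
qed

lemma graded_End_apply:
  assumes "x \<in> carrier (gmod A k)"
  shows "(f \<oplus>\<^bsub>graded_End_mod R A i\<^esub> g) k x = f k x \<oplus>\<^bsub>gmod A (i + k)\<^esub> g k x"
    and "(r \<odot>\<^bsub>graded_End_mod R A i\<^esub> f) k x = r \<odot>\<^bsub>gmod A (i + k)\<^esub> f k x"
    and "\<zero>\<^bsub>graded_End_mod R A i\<^esub> k x = \<zero>\<^bsub>gmod A (i + k)\<^esub>"
  using assms by (simp_all add: graded_End_mod_def)

lemma linear_maps_zero: "(\<lambda>x. \<zero>\<^bsub>gmod A n\<^esub>) \<in> linear_maps R (gmod A k) (gmod A n)"
  by (rule linear_mapsI) simp_all

lemma graded_End_zero_closed: "\<zero>\<^bsub>graded_End_mod R A i\<^esub> \<in> carrier (graded_End_mod R A i)"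
proof -
  have "\<zero>\<^bsub>graded_End_mod R A i\<^esub> = restrict_family A (\<lambda>k x. \<zero>\<^bsub>gmod A (i + k)\<^esub>)"
    by (simp add: graded_End_mod_def)
  then show ?thesis by (simp add: linear_maps_zero)
qed

lemma graded_End_add_closed:
  assumes f: "f \<in> carrier (graded_End_mod R A i)" and g: "g \<in> carrier (graded_End_mod R A i)"
  shows "f \<oplus>\<^bsub>graded_End_mod R A i\<^esub> g \<in> carrier (graded_End_mod R A i)"
proof -
  have "f \<oplus>\<^bsub>graded_End_mod R A i\<^esub> g =
      restrict_family A (\<lambda>k x. f k x \<oplus>\<^bsub>gmod A (i + k)\<^esub> g k x)"
    by (simp add: graded_End_mod_def)
  moreover have "(\<lambda>x. f k x \<oplus>\<^bsub>gmod A (i + k)\<^esub> g k x) \<in> linear_maps R (gmod A k) (gmod A (i + k))"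
    for k
    by (rule linear_mapsI)
      (simp_all add: graded_End_closed[OF f] graded_End_closed[OF g]
        graded_End_map_simps[OF f] graded_End_map_simps[OF g] gmod.M.a_ac
        gmod.smult_r_distr)
  ultimately show ?thesis by simp
qed

lemma graded_End_smult_closed:
  assumes r [simp]: "r \<in> carrier R" and f: "f \<in> carrier (graded_End_mod R A i)"
  shows "r \<odot>\<^bsub>graded_End_mod R A i\<^esub> f \<in> carrier (graded_End_mod R A i)"
proof -
  have "r \<odot>\<^bsub>graded_End_mod R A i\<^esub> f = restrict_family A (\<lambda>k x. r \<odot>\<^bsub>gmod A (i + k)\<^esub> f k x)"
    by (simp add: graded_End_mod_def)
  moreover have "(\<lambda>x. r \<odot>\<^bsub>gmod A (i + k)\<^esub> f k x) \<in> linear_maps R (gmod A k) (gmod A (i + k))" for k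
    \<comment> \<open>Commutativity of the ground ring is essential: a scalar multiple of a linear
      map is compatible with scalars because r(sx) = s(rx).\<close>
    by (rule linear_mapsI)
      (simp_all add: graded_End_closed[OF f] graded_End_map_simps[OF f]
        gmod.smult_r_distr gmod.smult_assoc1[symmetric] gmod.m_comm)
  ultimately show ?thesis by simp
qed

lemma module_graded_End: "module R (graded_End_mod R A i)"
proof (rule moduleI)
  show "cring R"
    using gmod.is_cring .
  note closed = graded_End_add_closed graded_End_smult_closed graded_End_zero_closed
  show "abelian_group (graded_End_mod R A i)"
  proof (rule abelian_groupI)
    fix f assume f: "f \<in> carrier (graded_End_mod R A i)"
    \<comment> \<open>The group axiom asks for an inverse to exist; the pointwise negative is the
      witness.\<close>
    define g where "g = restrict_family A (\<lambda>k x. \<ominus>\<^bsub>gmod A (i + k)\<^esub> f k x)"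
    have "(\<lambda>x. \<ominus>\<^bsub>gmod A (i + k)\<^esub> f k x) \<in> linear_maps R (gmod A k) (gmod A (i + k))" for k
      by (rule linear_mapsI)
        (simp_all add: graded_End_closed[OF f] graded_End_map_simps[OF f] gmod.M.minus_add
          gmod.smult_r_minus)
    then have g: "g \<in> carrier (graded_End_mod R A i)"
      by (simp add: g_def)
    have "g \<oplus>\<^bsub>graded_End_mod R A i\<^esub> f = \<zero>\<^bsub>graded_End_mod R A i\<^esub>"
      by (rule graded_End_eqI[of _ i])
        (simp_all add: closed f g graded_End_apply, simp add: g_def graded_End_closed[OF f] gmod.M.l_neg)
    with g show "\<exists>g\<in>carrier (graded_End_mod R A i).
        g \<oplus>\<^bsub>graded_End_mod R A i\<^esub> f = \<zero>\<^bsub>graded_End_mod R A i\<^esub>"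
      by blast
  qed (auto intro!: graded_End_eqI[of _ i]
      simp: closed graded_End_apply graded_End_closed gmod.M.a_ac)
qed (auto intro!: graded_End_eqI[of _ i] graded_End_add_closed graded_End_smult_closed
    simp: graded_End_apply graded_End_closed gmod.smult_l_distr
    gmod.smult_r_distr gmod.smult_assoc1)

lemma gmod_graded_End [simp]: "gmod (graded_End R A) = graded_End_mod R A"
  by (simp add: graded_End_def)

lemma graded_End_gmult_apply:
  "x \<in> carrier (gmod A k) \<Longrightarrow> gmult (graded_End R A) i j f g k x = f (j + k) (g k x)"
  by (simp add: graded_End_def)

lemma graded_End_gone_apply: "x \<in> carrier (gmod A k) \<Longrightarrow> gone (graded_End R A) k x = x"
  by (simp add: graded_End_def)

lemma graded_End_gmult_closed:
  assumes f: "f \<in> carrier (graded_End_mod R A i)" and g: "g \<in> carrier (graded_End_mod R A j)"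
    and n: "n = i + j"
  shows "gmult (graded_End R A) i j f g \<in> carrier (graded_End_mod R A n)"
proof -
  have "(\<lambda>x. f (j + k) (g k x)) \<in> linear_maps R (gmod A k) (gmod A (n + k))" for k
    by (rule linear_mapsI)
      (simp_all add: graded_End_closed[OF f] graded_End_closed[OF g] n
        graded_End_map_simps[OF f, where n = "i + j + k"]
        graded_End_map_simps[OF g, where n = "j + k"])
  then show ?thesis by (simp add: graded_End_def)
qed

lemma graded_End_gone_closed: "gone (graded_End R A) \<in> carrier (graded_End_mod R A 0)"
  by (simp add: graded_End_def) (auto intro: linear_mapsI)

lemma graded_algebra_graded_End: "graded_algebra R (graded_End R A)"
proof (rule graded_algebra.intro, unfold gmod_graded_End)
  show "module R (graded_End_mod R A i)" for i
    by (rule module_graded_End)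
  show "gone (graded_End R A) \<in> carrier (graded_End_mod R A 0)"
    by (rule graded_End_gone_closed)
  show "gmult (graded_End R A) i j \<in>
      bilinear_maps R (graded_End_mod R A i) (graded_End_mod R A j) (graded_End_mod R A (i + j))"
    for i j
    \<comment> \<open>The first goal is a closure statement, not an equation, hence the optional use
      of extensionality.\<close>
    by (rule bilinear_mapsI; (rule graded_End_eqI[of _ "i + j"])?)
      (auto intro!: graded_End_gmult_closed graded_End_add_closed graded_End_smult_closed
        simp: graded_End_gmult_apply graded_End_apply graded_End_closed
          graded_End_map_simps[where n = "i + j + k" for k] add.assoc)
next
  fix f g h i j k
  assume "f \<in> carrier (graded_End_mod R A i)" "g \<in> carrier (graded_End_mod R A j)"
    "h \<in> carrier (graded_End_mod R A k)"
  then show "gmult (graded_End R A) (i + j) k (gmult (graded_End R A) i j f g) h =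
      gmult (graded_End R A) i (j + k) f (gmult (graded_End R A) j k g h)"
    by (intro graded_End_eqI[of _ "i + j + k"])
      (auto intro!: graded_End_gmult_closed
        simp: graded_End_gmult_apply graded_End_closed add.assoc)
next
  fix f i
  assume f: "f \<in> carrier (graded_End_mod R A i)"
  then show "gmult (graded_End R A) 0 i (gone (graded_End R A)) f = f"
    by (intro graded_End_eqI[of _ i])
      (auto intro!: graded_End_gmult_closed graded_End_gone_closed
        simp: graded_End_gmult_apply graded_End_gone_apply graded_End_closed)
  from f show "gmult (graded_End R A) i 0 f (gone (graded_End R A)) = f"
    by (intro graded_End_eqI[of _ i])
      (auto intro!: graded_End_gmult_closed graded_End_gone_closed
        simp: graded_End_gmult_apply graded_End_gone_apply graded_End_closed)
qed

lemma graded_End_a_inv_closed: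
  "f \<in> carrier (graded_End_mod R A i) \<Longrightarrow>
   \<ominus>\<^bsub>graded_End_mod R A i\<^esub> f \<in> carrier (graded_End_mod R A i)"
  using abelian_group.a_inv_closed[OF module.axioms(2)[OF module_graded_End]] .

text \<open>Negation in the endomorphism module is only characterised by the group structure and has
  no pointwise definition. Evaluating the identity (-f) + f = 0 at \<open>x\<close> identifies its
  values by uniqueness of inverses.\<close>

lemma graded_End_a_inv_apply:
  assumes f: "f \<in> carrier (graded_End_mod R A i)" and x: "x \<in> carrier (gmod A k)"
  shows "(\<ominus>\<^bsub>graded_End_mod R A i\<^esub> f) k x = \<ominus>\<^bsub>gmod A (i + k)\<^esub> f k x"
proof (rule gmod.M.minus_equality[symmetric])
  have "(\<ominus>\<^bsub>graded_End_mod R A i\<^esub> f \<oplus>\<^bsub>graded_End_mod R A i\<^esub> f) k x =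
      \<zero>\<^bsub>gmod A (i + k)\<^esub>"
    using x abelian_group.l_neg[OF module.axioms(2)[OF module_graded_End] f]
    by (simp add: graded_End_apply)
  then show "(\<ominus>\<^bsub>graded_End_mod R A i\<^esub> f) k x \<oplus>\<^bsub>gmod A (i + k)\<^esub> f k x = \<zero>\<^bsub>gmod A (i + k)\<^esub>"
    using x by (simp add: graded_End_apply)
qed (use f x graded_End_a_inv_closed in \<open>auto intro: graded_End_closed\<close>)

lemma graded_End_commutator_apply:
  assumes f: "f \<in> carrier (graded_End_mod R A i)" and g: "g \<in> carrier (graded_End_mod R A j)"
    and x: "x \<in> carrier (gmod A k)" and deg: "n = i + j + k" "jk = j + k" "ik = i + k"
  shows "graded_commutator (graded_End R A) i j f g k x =
    f jk (g k x) \<ominus>\<^bsub>gmod A n\<^esub> signed (gmod A n) (i * j) (g ik (f k x))"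
proof -
  have "gmult (graded_End R A) j i g f \<in> carrier (graded_End_mod R A (i + j))"
    using f g by (simp add: graded_End_gmult_closed)
  then show ?thesis
    using x
    by (auto simp: graded_commutator_def a_minus_def signed_def graded_End_apply
        graded_End_a_inv_apply graded_End_a_inv_closed graded_End_gmult_apply deg)
qed

section \<open>Left multiplication\<close>

lemma left_mult_apply: "x \<in> carrier (gmod A k) \<Longrightarrow> left_mult A i a k x = gmult A i k a x"
  by (simp add: left_mult_def)

lemma left_mult_closed:
  "a \<in> carrier (gmod A i) \<Longrightarrow> left_mult A i a \<in> carrier (graded_End_mod R A i)"
  using gmult_bilinear by (auto simp: left_mult_def bilinear_maps_def)

lemma left_mult_linear: "left_mult A i \<in> linear_maps R (gmod A i) (graded_End_mod R A i)"
  by (rule linear_mapsI; (rule graded_End_eqI[of _ i])?)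
    (auto intro!: left_mult_closed graded_End_add_closed graded_End_smult_closed
      simp: left_mult_apply graded_End_apply gmult_left_simps)

lemma left_mult_gone: "left_mult A 0 (gone A) = gone (graded_End R A)"
  by (rule graded_End_eqI[of _ 0])
    (auto intro: left_mult_closed gone_closed graded_End_gone_closed
      simp: left_mult_apply graded_End_gone_apply gone_left)

lemma left_mult_gmult:
  "\<lbrakk>a \<in> carrier (gmod A i); b \<in> carrier (gmod A j)\<rbrakk> \<Longrightarrow>
   left_mult A (i + j) (gmult A i j a b) =
   gmult (graded_End R A) i j (left_mult A i a) (left_mult A j b)"
  by (rule graded_End_eqI[of _ "i + j"])
    (auto intro!: left_mult_closed graded_End_gmult_closed gmult_closed gmult_assoc
      simp: left_mult_apply graded_End_gmult_apply gmult_closed)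

lemma inj_on_left_mult: "inj_on (left_mult A i) (carrier (gmod A i))"
proof (rule inj_onI)
  fix a b
  assume "a \<in> carrier (gmod A i)" "b \<in> carrier (gmod A i)" "left_mult A i a = left_mult A i b"
  then show "a = b"
    using gone_right left_mult_apply[OF gone_closed] by metis
qed

end

section \<open>The negative of the Batalin-Vilkovisky operator as a square-zero element, and its
  derived bracket on left multiplications\<close>

context batalin_vilkovisky_algebra
begin

text \<open>The operator is unconstrained off the carriers, so it has to be normalised by
  \<open>restrict_family\<close> before it is an element of the endomorphism algebra.\<close>

definition d :: "int \<Rightarrow> 'a \<Rightarrow> 'a" where
  "d = \<ominus>\<^bsub>graded_End_mod R A 1\<^esub> restrict_family A \<Delta>"

lemma Delta_closed: "\<lbrakk>x \<in> carrier (gmod A k); n = k + 1\<rbrakk> \<Longrightarrow> \<Delta> k x \<in> carrier (gmod A n)"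
  using Delta_linear[of k] by (auto simp: linear_maps_def)

lemma Delta_End: "restrict_family A \<Delta> \<in> carrier (graded_End_mod R A 1)"
  using Delta_linear by (simp add: add.commute)

lemma d_closed: "d \<in> carrier (graded_End_mod R A 1)"
  unfolding d_def by (rule graded_End_a_inv_closed[OF Delta_End])

lemma d_apply: "\<lbrakk>x \<in> carrier (gmod A k); n = k + 1\<rbrakk> \<Longrightarrow> d k x = \<ominus>\<^bsub>gmod A n\<^esub> \<Delta> k x"
  unfolding d_def by (simp add: graded_End_a_inv_apply[OF Delta_End] add.commute)

sublocale End: square_zero R "graded_End R A" d
proof (intro square_zero.intro square_zero_axioms.intro)
  show "graded_algebra R (graded_End R A)"
    by (rule graded_algebra_graded_End)
  show "d \<in> carrier (gmod (graded_End R A) 1)"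
    by (simp add: d_closed)
  show "gmult (graded_End R A) 1 1 d d = \<zero>\<^bsub>gmod (graded_End R A) 2\<^esub>"
    unfolding gmod_graded_End
  proof (rule graded_End_eqI[of _ 2])
    fix k x assume x: "x \<in> carrier (gmod A k)"
    \<comment> \<open>Linearity of the outer operator pulls out the inner minus sign, which cancels
      against the outer one.\<close>
    interpret D: linear_map R "gmod A (k + 1)" "gmod A (k + 2)" "\<Delta> (k + 1)"
      using Delta_linear[of "k + 1"]
      by (auto intro!: linear_map.intro linear_map_axioms.intro module_gmod
          simp: add.commute[of 2])
    show "gmult (graded_End R A) 1 1 d d k x = \<zero>\<^bsub>graded_End_mod R A 2\<^esub> k x"
      using x by (simp add: graded_End_gmult_apply graded_End_apply d_apply[where n = "k + 1"]
          d_apply[where n = "k + 2"] Delta_closed add.commute[of 1] add.commute[of 2]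
          D.map_a_inv Delta_Delta)
  qed (simp_all add: graded_End_gmult_closed d_closed graded_End_zero_closed)
qed

text \<open>The commutator evaluates to -S + (-1)^i P, while the defining formula gives the bracket
  as (-1)^i P - (-1)^i Q - S. The two differ by exactly (-1)^i Q, and the minus sign in
  \<open>d\<close> is what makes the bracket appear with a plus.\<close>

lemma commutator_left_mult_d_apply:
  assumes a: "a \<in> carrier (gmod A i)" and x: "x \<in> carrier (gmod A k)" and n: "n = i + k + 1"
  shows "graded_commutator (graded_End R A) i 1 (left_mult A i a) d k x =
    gbracket A i k a x \<oplus>\<^bsub>gmod A n\<^esub> signed (gmod A n) i (gmult A (i + 1) k (\<Delta> i a) x)"
proof -
  define P where "P = \<Delta> (i + k) (gmult A i k a x)"
  define Q where "Q = gmult A (i + 1) k (\<Delta> i a) x"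
  define S where "S = gmult A i (k + 1) a (\<Delta> k x)"
  have ax: "gmult A i k a x \<in> carrier (gmod A (i + k))"
    using a x by (simp add: gmult_closed)
  have [simp]: "P \<in> carrier (gmod A n)" "Q \<in> carrier (gmod A n)" "S \<in> carrier (gmod A n)"
    unfolding P_def Q_def S_def using a x ax by (auto intro!: gmult_closed Delta_closed simp: n)
  have "graded_commutator (graded_End R A) i 1 (left_mult A i a) d k x =
      left_mult A i a (k + 1) (d k x) \<ominus>\<^bsub>gmod A n\<^esub>
      signed (gmod A n) (i * 1) (d (i + k) (left_mult A i a k x))"
    by (rule graded_End_commutator_apply) (simp_all add: left_mult_closed a d_closed x n)
  also have "left_mult A i a (k + 1) (d k x) = \<ominus>\<^bsub>gmod A n\<^esub> S"
    using a x by (simp add: d_apply[where n = "k + 1"] left_mult_apply Delta_closed S_def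
        gmult_right_simps[where k = n] n)
  also have "d (i + k) (left_mult A i a k x) = \<ominus>\<^bsub>gmod A n\<^esub> P"
    using x ax by (simp add: left_mult_apply d_apply[where n = n] P_def n)
  finally have 1: "graded_commutator (graded_End R A) i 1 (left_mult A i a) d k x =
    \<ominus>\<^bsub>gmod A n\<^esub> S \<ominus>\<^bsub>gmod A n\<^esub> signed (gmod A n) (i * 1) (\<ominus>\<^bsub>gmod A n\<^esub> P)" .
  have 2: "gbracket A i k a x = signed (gmod A n) i
      (P \<ominus>\<^bsub>gmod A n\<^esub> Q \<ominus>\<^bsub>gmod A n\<^esub> signed (gmod A n) i S)"
    unfolding P_def Q_def S_def n using gbracket_Delta[OF a x] .
  show ?thesis
    unfolding 1 2 Q_def[symmetric]
    by (cases "even i")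
      (simp_all add: signed_def a_minus_def gmod.M.minus_add gmod.M.a_ac gmod.M.r_neg gmod.M.l_neg
        gmod.M.r_neg1 gmod.M.r_neg2 gmod.M.a_inv_lcancel)
qed

lemma left_mult_gbracket:
  assumes a: "a \<in> carrier (gmod A i)" and b: "b \<in> carrier (gmod A j)"
  shows "left_mult A (i + j + 1) (gbracket A i j a b) =
    derived_bracket (graded_End R A) d i j (left_mult A i a) (left_mult A j b)"
proof (rule graded_End_eqI[of _ "i + j + 1"])
  \<comment> \<open>The degrees are bound afresh, because the fact is needed both for {a, b} and for
    {a, x}.\<close>
  have br: "gbracket A i j x y \<in> carrier (gmod A (i + j + 1))"
    if "x \<in> carrier (gmod A i)" "y \<in> carrier (gmod A j)" for i j x y
    using gbracket_bilinear[of i j] that by (auto simp: bilinear_maps_def linear_maps_def)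
  show "left_mult A (i + j + 1) (gbracket A i j a b) \<in> carrier (graded_End_mod R A (i + j + 1))"
    using a b by (auto intro: left_mult_closed br)
  show "derived_bracket (graded_End R A) d i j (left_mult A i a) (left_mult A j b)
      \<in> carrier (graded_End_mod R A (i + j + 1))"
    using End.derived_bracket_closed[of "left_mult A i a" i "left_mult A j b" j] a b
    by (simp add: left_mult_closed)
  fix k x assume x: "x \<in> carrier (gmod A k)"
  define n where "n = i + j + k + 1"
  define F where "F = graded_commutator (graded_End R A) i 1 (left_mult A i a) d"
  define u where "u = gmult A j k b x"
  define D where "D = \<Delta> i a"
  have F: "F \<in> carrier (graded_End_mod R A (i + 1))"
    unfolding F_def using End.commutator_closed[of "left_mult A i a" i d 1] a
    by (simp add: left_mult_closed d_closed)
  have D: "D \<in> carrier (gmod A (i + 1))" and u: "u \<in> carrier (gmod A (j + k))"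
    using a b x by (auto simp: D_def u_def intro: Delta_closed gmult_closed)
  define X where "X = gmult A (i + j + 1) k (gbracket A i j a b) x"
  define Y where "Y = gmult A j (i + k + 1) b (gbracket A i k a x)"
  define Z where "Z = gmult A (i + 1) (j + k) D u"
  have [simp]: "X \<in> carrier (gmod A n)" "Y \<in> carrier (gmod A n)" "Z \<in> carrier (gmod A n)"
    unfolding X_def Y_def Z_def using a b x u D
    by (auto intro!: gmult_closed br simp: n_def)
  \<comment> \<open>The Leibniz rule splits {a, bx} into X = {a, b}x, the value wanted in the end,
    and a signed Y = b{a, x}.\<close>
  have Fu: "F (j + k) u =
      (X \<oplus>\<^bsub>gmod A n\<^esub> signed (gmod A n) ((i + 1) * j) Y) \<oplus>\<^bsub>gmod A n\<^esub> signed (gmod A n) i Z"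
    unfolding F_def
    using commutator_left_mult_d_apply[OF a u, of n] gbracket_gmult[OF a b x]
    by (simp add: n_def D_def Z_def X_def Y_def u_def add.assoc)
  have Dx: "gmult A (i + 1) k D x \<in> carrier (gmod A (i + k + 1))"
    using D x by (auto intro: gmult_closed)
  \<comment> \<open>Graded commutativity of \<open>A\<close> enters here: moving \<open>b\<close>
    past \<open>D\<close> shows that left multiplications by the two commute up to the usual sign,
    so this term is again a multiple of Z.\<close>
  have "gmult A j (i + k + 1) b (gmult A (i + 1) k D x) =
      gmult A (i + j + 1) k (gmult A j (i + 1) b D) x"
    using gmult_assoc'[OF b D x, of "i + j + 1" "i + k + 1"] by simp
  also have "gmult A j (i + 1) b D =
      signed (gmod A (i + j + 1)) (j * (i + 1)) (gmult A (i + 1) j D b)"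
    using gmult_comm[OF b D] by (simp add: ac_simps)
  also have "gmult A (i + j + 1) k \<dots> x = signed (gmod A n) (j * (i + 1)) Z"
    using gmult_assoc'[OF D b x, of "i + j + 1" "j + k"] D b x
    by (simp add: gmult_left_simps[where k = n] n_def gmult_closed Z_def u_def)
  finally have comm: "gmult A j (i + k + 1) b (gmult A (i + 1) k D x) = \<dots>" .
  have lF: "left_mult A j b (i + k + 1) (F k x) =
      Y \<oplus>\<^bsub>gmod A n\<^esub> signed (gmod A n) i (signed (gmod A n) (j * (i + 1)) Z)"
    unfolding F_def
    using commutator_left_mult_d_apply[OF a x, of "i + k + 1"] b Dx br[OF a x]
    by (simp add: left_mult_apply D_def[symmetric] gmult_right_simps[where k = n] comm n_def
        Y_def[symmetric])
  have "derived_bracket (graded_End R A) d i j (left_mult A i a) (left_mult A j b) k x =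
      F (j + k) (left_mult A j b k x) \<ominus>\<^bsub>gmod A n\<^esub>
      signed (gmod A n) ((i + 1) * j) (left_mult A j b (i + k + 1) (F k x))"
    unfolding derived_bracket_def F_def[symmetric]
    by (rule graded_End_commutator_apply) (simp_all add: F left_mult_closed b x n_def)
  also have "left_mult A j b k x = u"
    using x by (simp add: left_mult_apply u_def)
  also have "F (j + k) u \<ominus>\<^bsub>gmod A n\<^esub>
      signed (gmod A n) ((i + 1) * j) (left_mult A j b (i + k + 1) (F k x)) = X"
    unfolding Fu lF
    \<comment> \<open>Y occurs twice with the sign of (i + 1)j and cancels. In the second copy of Z
      the sign of (i + 1)j occurs twice, so both copies carry the sign of i and cancel as
      well.\<close>
    by (cases "even i"; cases "even j")
      (simp_all add: signed_def a_minus_def gmod.M.minus_add gmod.M.a_ac gmod.M.r_neg gmod.M.l_neg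
        gmod.M.r_neg1 gmod.M.r_neg2)
  finally show "left_mult A (i + j + 1) (gbracket A i j a b) k x =
      derived_bracket (graded_End R A) d i j (left_mult A i a) (left_mult A j b) k x"
    using x by (simp add: left_mult_apply X_def)
qed

lemma gen_loday_gerstenhaber_hom_left_mult:
  "gen_loday_gerstenhaber_hom R A (derived_algebra (graded_End R A) d) (left_mult A)"
  by (intro gen_loday_gerstenhaber_hom.intro gen_loday_gerstenhaber_hom_axioms.intro
      End.gen_loday_gerstenhaber_derived_algebra gen_loday_gerstenhaber_algebra_axioms)
    (simp_all add: End.derived_algebra_simps left_mult_linear left_mult_gone left_mult_gmult
      left_mult_gbracket)

end

theorem theorem66:
  fixes R :: "('k, 'r) ring_scheme"
    and A :: "('k, 'a, 'm) bracket_algebra_scheme"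
    and \<Delta> :: "int \<Rightarrow> 'a \<Rightarrow> 'a"
  assumes "batalin_vilkovisky_algebra R A \<Delta>"
  shows "gen_loday_gerstenhaber_hom R A
           (derived_algebra (graded_End R A)
              (\<ominus>\<^bsub>gmod (graded_End R A) 1\<^esub> restrict_family A \<Delta>))
           (left_mult A)
       \<and> (\<forall>i. inj_on (left_mult A i) (carrier (gmod A i)))"
proof -
  interpret batalin_vilkovisky_algebra R A \<Delta> by fact
  show ?thesis
    using gen_loday_gerstenhaber_hom_left_mult inj_on_left_mult by (simp add: d_def)
qed

end
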